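(* Let $n \geq 7$ be an integer and let $A_4 = \begin{bmatrix} 0 & 3 \\ 1 & 2 \end{bmatrix}$. If $4 \mid n$, then the generalized Petersen graph $GP(n,3)$ has a perfect 2-coloring with the matrix $A_4$. If $4 \nmid n$, then $GP(n,3)$ has no perfect 2-coloring with the matrix $A_4$.
   Context: For integers $n \geq 3$ and $1 \leq k < n/2$, the generalized Petersen graph $GP(n,k)$ is the cubic graph with vertex set $\{a_i, b_i : 0 \leq i \leq n-1\}$ and edge set $\{a_i a_{i+1},\ a_i b_i,\ b_i b_{i+k} : 0 \leq i \leq n-1\}$, with indices taken modulo $n$. For a graph $G$ and an integer $m$, a mapping $T: V(G) \to \{1,\dots,m\}$ is called a perfect $m$-coloring with matrix $A = (a_{ij})_{i,j \in \{1,\dots,m\}}$ if $T$ is surjective and for all $i,j$, every vertex of color $i$ has exactly $a_{ij}$ neighbors of color $j$. (Perfect 2-colorings are considered up to renaming the two colors.) *)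

theory Defs
  imports Jordan_Normal_Form.Matrix
begin

text \<open>A graph is given by its vertex set together with its edge set, a set of unordered pairs.\<close>

type_synonym 'v graph = "'v set \<times> 'v set set"

definition vertices :: "'v graph \<Rightarrow> 'v set" where
  "vertices G = fst G"

definition edges :: "'v graph \<Rightarrow> 'v set set" where
  "edges G = snd G"

definition neighbours :: "'v graph \<Rightarrow> 'v \<Rightarrow> 'v set" where
  "neighbours G v = {w \<in> vertices G. {v, w} \<in> edges G}"

datatype gp_vertex = Outer nat | Inner nat

text \<open>\<open>Outer i\<close> is the vertex $a_i$ and \<open>Inner i\<close> the vertex $b_i$, where \<open>i\<close> is the
  representative in \<open>{0..<n}\<close> of its residue class modulo \<open>n\<close>.  The definition is meant for
  \<open>n \<ge> 3\<close> and \<open>1 \<le> k\<close>, \<open>2 * k < n\<close>; only then is the graph simple and cubic.\<close>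

definition GP :: "nat \<Rightarrow> nat \<Rightarrow> gp_vertex graph" where
  "GP n k =
    (Outer ` {0..<n} \<union> Inner ` {0..<n},
     (\<Union>i\<in>{0..<n}. {{Outer i, Outer ((i + 1) mod n)},
                     {Outer i, Inner i},
                     {Inner i, Inner ((i + k) mod n)}}))"

text \<open>The colours are \<open>1, \<dots>, m\<close>, but matrices are indexed from \<open>0\<close>, hence the
  shift by one.  The equation \<open>T ` vertices G = {1..m}\<close> says both that \<open>T\<close> maps the
  vertices into \<open>{1..m}\<close> and that it is surjective.\<close>

definition perfect_coloring :: "'v graph \<Rightarrow> nat \<Rightarrow> nat mat \<Rightarrow> ('v \<Rightarrow> nat) \<Rightarrow> bool" where
  "perfect_coloring G m A T \<longleftrightarrow>
     A \<in> carrier_mat m m \<and>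
     T ` vertices G = {1..m} \<and>
     (\<forall>i\<in>{1..m}. \<forall>j\<in>{1..m}. \<forall>v\<in>vertices G. T v = i \<longrightarrow>
        card {w \<in> neighbours G v. T w = j} = A $$ (i - 1, j - 1))"

definition A4 :: "nat mat" where
  "A4 = mat_of_rows_list 2 [[0, 3],
                            [1, 2]]"

end

theory Submission
  imports Defs "HOL-Number_Theory.Cong"
begin

text \<open>
  In a cubic graph, the vertices of the first colour of a perfect 2-colouring with matrix
  \<open>A4\<close> form a \<^emph>\<open>perfect code\<close>: every closed neighbourhood contains exactly one of them.
  Conversely every perfect code gives such a colouring (\<open>ex_perfect_coloring_A4_iff\<close>), so
  the question is when \<open>GP n 3\<close> has a perfect code.

  The indicator functions of a set of vertices on the outer and the inner rim can be read as
  \<open>n\<close>-periodic 0/1 sequences \<open>a\<close>, \<open>b\<close>, and the code condition becomes the linear system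
  \<open>a(i-1) + a(i) + a(i+1) + b(i) = 1\<close> and \<open>b(i-3) + b(i) + b(i+3) + a(i) = 1\<close>
  (\<open>perfect_code_GP_iff\<close>). If \<open>4\<close> divides \<open>n\<close>, it is solved by letting \<open>a\<close> be supported on
  the indices congruent to \<open>0\<close> and \<open>b\<close> on those congruent to \<open>2\<close> modulo \<open>4\<close>.

  For the converse, the first equation says that any three consecutive values of \<open>a\<close>
  contain at most one \<open>1\<close>. Using it to eliminate \<open>b\<close> from the second equation leaves the
  condition that the eight values \<open>a(i-4), \<dots>, a(i+4)\<close> other than \<open>a(i)\<close> always sum to \<open>2\<close>.
  At an index with \<open>a(i) = 1\<close> this forces exactly one \<open>1\<close> among \<open>a(i+3), a(i+4)\<close> and
  one among \<open>a(i-3), a(i-4)\<close>. If two ones were at distance \<open>3\<close>, at \<open>i\<close> and \<open>i+3\<close>, the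
  condition at \<open>i+1\<close> would put the previous one at \<open>i-4\<close>, and then the eight values
  around \<open>i-1\<close> would contain three ones. Hence the ones of \<open>a\<close> are exactly \<open>4\<close> apart, and
  as \<open>a\<close> has period \<open>n\<close>, \<open>4\<close> divides \<open>n\<close>.
\<close>

section \<open>Perfect codes in cubic graphs\<close>

definition perfect_code :: "'v graph \<Rightarrow> 'v set \<Rightarrow> bool" where
  "perfect_code G S \<longleftrightarrow>
     S \<subseteq> vertices G \<and> (\<forall>v\<in>vertices G. card (insert v (neighbours G v) \<inter> S) = 1)"

text \<open>
  A loop would make a vertex of the first colour its own neighbour of that colour, so closed
  neighbourhoods count correctly only without loops.
\<close>

definition cubic :: "'v graph \<Rightarrow> bool" where
  "cubic G \<longleftrightarrow> (\<forall>v\<in>vertices G. v \<notin> neighbours G v \<and> card (neighbours G v) = 3)"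

lemma cubicD:
  assumes "cubic G" "v \<in> vertices G"
  shows "v \<notin> neighbours G v" "card (neighbours G v) = 3" "finite (neighbours G v)"
  using assms unfolding cubic_def by (auto intro: card_ge_0_finite)

lemma A4_simps [simp]:
  "A4 \<in> carrier_mat 2 2"
  "A4 $$ (0, 0) = 0" "A4 $$ (0, Suc 0) = 3" "A4 $$ (Suc 0, 0) = 1" "A4 $$ (Suc 0, Suc 0) = 2"
  by (auto simp: A4_def mat_of_rows_list_def)

lemma atLeastAtMost_one_two: "{1..2::nat} = {1, 2}"
  by auto

lemma perfect_code_of_coloring:
  assumes "cubic G" and T: "perfect_coloring G 2 A4 T"
  shows "perfect_code G {v \<in> vertices G. T v = 1}"
  unfolding perfect_code_def
proof (intro conjI ballI)
  fix v assume v: "v \<in> vertices G"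
  let ?S = "{v \<in> vertices G. T v = 1}"
  let ?N = "{w \<in> neighbours G v. T w = 1}"
  have fin: "finite ?N" and vN: "v \<notin> ?N"
    using cubicD[OF \<open>cubic G\<close> v] by auto
  have "T v \<in> {1, 2}"
    using T v unfolding perfect_coloring_def atLeastAtMost_one_two by blast
  moreover have "card ?N = A4 $$ (T v - 1, 0)"
    using T v \<open>T v \<in> {1, 2}\<close> unfolding perfect_coloring_def atLeastAtMost_one_two by auto
  moreover have "insert v (neighbours G v) \<inter> ?S = (if T v = 1 then insert v ?N else ?N)"
    using v by (auto simp: neighbours_def)
  ultimately show "card (insert v (neighbours G v) \<inter> ?S) = 1"
    using fin vN by (elim insertE) simp_all
qed auto

text \<open>
  Only the first column of the matrix has to be checked against the code condition; the
  second one follows because the rows of \<open>A4\<close> sum to the degree.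
\<close>

lemma coloring_of_perfect_code:
  assumes "cubic G" "vertices G \<noteq> {}" and S: "perfect_code G S"
  shows "perfect_coloring G 2 A4 (\<lambda>v. if v \<in> S then 1 else 2)"
proof -
  let ?T = "\<lambda>v. if v \<in> S then 1 else 2 :: nat"
  have first: "card (neighbours G v \<inter> S) = (if v \<in> S then 0 else 1)" if v: "v \<in> vertices G" for v
  proof -
    have "card (insert v (neighbours G v) \<inter> S) = 1"
      using S v by (auto simp: perfect_code_def)
    thus ?thesis
      using cubicD[OF \<open>cubic G\<close> v] by (auto simp: Int_insert_left split: if_splits)
  qed
  have second: "card (neighbours G v - S) = (if v \<in> S then 3 else 2)" if v: "v \<in> vertices G" for v
    using first[OF v] cubicD[OF \<open>cubic G\<close> v] by (simp add: card_Diff_subset_Int split: if_splits)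
  have "?T ` vertices G = {1, 2}"
  proof -
    obtain v where v: "v \<in> vertices G" using assms(2) by blast
    have "insert v (neighbours G v) \<inter> S \<noteq> {}"
      using S v unfolding perfect_code_def by fastforce
    then obtain s where s: "s \<in> S" "s \<in> vertices G"
      using v by (auto simp: neighbours_def)
    hence "neighbours G s - S \<noteq> {}"
      using second[of s] by force
    then obtain w where "w \<in> vertices G" "w \<notin> S"
      by (auto simp: neighbours_def)
    thus ?thesis using s by (auto simp: image_iff)
  qed
  moreover have "{w \<in> neighbours G v. ?T w = 1} = neighbours G v \<inter> S"
    and "{w \<in> neighbours G v. ?T w = 2} = neighbours G v - S" for v
    by auto
  ultimately show ?thesis
    unfolding perfect_coloring_def atLeastAtMost_one_two using first second by auto
qed

lemma ex_perfect_coloring_A4_iff: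
  assumes "cubic G" "vertices G \<noteq> {}"
  shows "(\<exists>T. perfect_coloring G 2 A4 T) \<longleftrightarrow> (\<exists>S. perfect_code G S)"
  using perfect_code_of_coloring coloring_of_perfect_code assms by blast


section \<open>Perfect codes in generalized Petersen graphs\<close>

lemma vertices_GP: "vertices (GP n k) = Outer ` {0..<n} \<union> Inner ` {0..<n}"
  by (simp add: vertices_def GP_def)

lemma mod_add_right_cancel_nat: "(i + k) mod n = (j + k) mod n \<longleftrightarrow> i mod n = j mod (n::nat)"
  using cong_add_rcancel_nat[of i k j n] by (simp add: cong_def)

text \<open>
  Neighbourhoods are described at a shifted index, so that the predecessor on the rim needs
  no subtraction; every index has this form modulo \<open>n\<close>.
\<close>

lemma neighbours_GP:
  assumes "n > 0"
  shows "neighbours (GP n k) (Outer ((j + 1) mod n)) =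
           {Outer (j mod n), Outer ((j + 2) mod n), Inner ((j + 1) mod n)}" (is "?O")
    and "neighbours (GP n k) (Inner ((j + k) mod n)) =
           {Inner (j mod n), Inner ((j + 2 * k) mod n), Outer ((j + k) mod n)}" (is "?I")
proof -
  have step: "(i + d) mod n = (j + 2 * d) mod n" if "i = (j + d) mod n" for i d
    using that by (simp add: mod_add_left_eq mult_2 add.assoc)
  have pred: "i = j mod n" if "(i + d) mod n = (j + d) mod n" "i < n" for i d
    using that by (simp add: mod_add_right_cancel_nat)
  have E: "e \<in> edges (GP n k) \<longleftrightarrow> (\<exists>i<n. e = {Outer i, Outer ((i + 1) mod n)} \<or>
      e = {Outer i, Inner i} \<or> e = {Inner i, Inner ((i + k) mod n)})" for e
    by (auto simp: edges_def GP_def)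
  have lt: "m mod n < n" for m using assms by simp
  show ?O
  proof (intro equalityI subsetI)
    fix w assume "w \<in> neighbours (GP n k) (Outer ((j + 1) mod n))"
    then show "w \<in> {Outer (j mod n), Outer ((j + 2) mod n), Inner ((j + 1) mod n)}"
      using step[of _ 1] pred[of _ 1] by (auto simp: neighbours_def E doubleton_eq_iff)
  next
    fix w assume "w \<in> {Outer (j mod n), Outer ((j + 2) mod n), Inner ((j + 1) mod n)}"
    moreover have "{Outer ((j + 1) mod n), Outer (j mod n)} \<in> edges (GP n k)"
      unfolding E using lt[of j] by (intro exI[of _ "j mod n"]) (auto simp: mod_Suc_eq)
    moreover have "{Outer ((j + 1) mod n), Outer ((j + 2) mod n)} \<in> edges (GP n k)"
      unfolding E using lt[of "j + 1"] step[of "(j + 1) mod n" 1]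
      by (intro exI[of _ "(j + 1) mod n"]) auto
    moreover have "{Outer ((j + 1) mod n), Inner ((j + 1) mod n)} \<in> edges (GP n k)"
      unfolding E using lt by auto
    ultimately show "w \<in> neighbours (GP n k) (Outer ((j + 1) mod n))"
      using lt by (auto simp: neighbours_def vertices_GP)
  qed
  show ?I
  proof (intro equalityI subsetI)
    fix w assume "w \<in> neighbours (GP n k) (Inner ((j + k) mod n))"
    then show "w \<in> {Inner (j mod n), Inner ((j + 2 * k) mod n), Outer ((j + k) mod n)}"
      using step[of _ k] pred[of _ k] by (auto simp: neighbours_def E doubleton_eq_iff)
  next
    fix w assume "w \<in> {Inner (j mod n), Inner ((j + 2 * k) mod n), Outer ((j + k) mod n)}"
    moreover have "{Inner ((j + k) mod n), Inner (j mod n)} \<in> edges (GP n k)"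
      unfolding E using lt[of j] by (intro exI[of _ "j mod n"]) (auto simp: mod_add_left_eq)
    moreover have "{Inner ((j + k) mod n), Inner ((j + 2 * k) mod n)} \<in> edges (GP n k)"
      unfolding E using lt[of "j + k"] step[of "(j + k) mod n" k]
      by (intro exI[of _ "(j + k) mod n"]) auto
    moreover have "{Inner ((j + k) mod n), Outer ((j + k) mod n)} \<in> edges (GP n k)"
      unfolding E using lt by auto
    ultimately show "w \<in> neighbours (GP n k) (Inner ((j + k) mod n))"
      using lt by (auto simp: neighbours_def vertices_GP)
  qed
qed

lemma ball_vertices_GP_shift:
  assumes "k \<le> n" "n > 0"
  shows "(\<forall>v\<in>vertices (GP n k). P v) \<longleftrightarrow>
         (\<forall>j. P (Outer ((j + 1) mod n)) \<and> P (Inner ((j + k) mod n)))"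
proof
  assume "\<forall>v\<in>vertices (GP n k). P v"
  thus "\<forall>j. P (Outer ((j + 1) mod n)) \<and> P (Inner ((j + k) mod n))"
    using assms by (auto simp: vertices_GP)
next
  assume *: "\<forall>j. P (Outer ((j + 1) mod n)) \<and> P (Inner ((j + k) mod n))"
  have "P (Outer i)" "P (Inner i)" if "i < n" for i
    using *[rule_format, of "i + n - 1"] *[rule_format, of "i + n - k"] that assms by auto
  thus "\<forall>v\<in>vertices (GP n k). P v" by (auto simp: vertices_GP)
qed

lemma mod_add_neq_self:
  assumes "0 < d" "d < (n::nat)"
  shows "j mod n \<noteq> (j + d) mod n"
  using mod_add_right_cancel_nat[of 0 j n d] assms by (auto simp: add.commute)

lemma rim_indices_distinct:
  assumes "1 \<le> k" "2 * k < (n::nat)"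
  shows "j mod n \<noteq> (j + k) mod n" "j mod n \<noteq> (j + 2 * k) mod n"
    "(j + k) mod n \<noteq> (j + 2 * k) mod n"
  using mod_add_neq_self[of k n j] mod_add_neq_self[of "2 * k" n j]
    mod_add_neq_self[of k n "j + k"] assms
  by (simp_all add: add.assoc mult_2)

lemma cubic_GP:
  assumes "1 \<le> k" "2 * k < n"
  shows "cubic (GP n k)"
proof -
  have n: "k \<le> n" "n > 0" "1 \<le> (1::nat)" "2 * 1 < n" using assms by auto
  show ?thesis
    unfolding cubic_def ball_vertices_GP_shift[OF n(1,2)] neighbours_GP[OF n(2)]
    using rim_indices_distinct[OF assms] rim_indices_distinct[OF n(3,4)] by simp metis
qed

text \<open>
  The four members of a closed neighbourhood are distinct, so the number of them in \<open>S\<close> is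
  the sum of four values of the indicator function of \<open>S\<close>.
\<close>

lemma perfect_code_GP_iff:
  fixes n k :: nat and S :: "gp_vertex set"
  defines "a \<equiv> \<lambda>i. of_bool (Outer (i mod n) \<in> S) :: nat"
    and "b \<equiv> \<lambda>i. of_bool (Inner (i mod n) \<in> S) :: nat"
  assumes "1 \<le> k" "2 * k < n"
  shows "perfect_code (GP n k) S \<longleftrightarrow> S \<subseteq> vertices (GP n k) \<and>
    (\<forall>j. a j + a (j + 1) + a (j + 2) + b (j + 1) = 1 \<and>
         b j + b (j + k) + b (j + 2 * k) + a (j + k) = 1)"
proof -
  have n: "k \<le> n" "n > 0" "1 \<le> (1::nat)" "2 * 1 < n" using assms by auto
  have card4: "card ({p, q, r, s} \<inter> S) =
      of_bool (p \<in> S) + of_bool (q \<in> S) + of_bool (r \<in> S) + of_bool (s \<in> S)"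
    if "distinct [p, q, r, s]" for p q r s
    using that by (simp add: Int_insert_left)
  have "card (insert (Outer ((j + 1) mod n)) (neighbours (GP n k) (Outer ((j + 1) mod n))) \<inter> S)
      = a j + a (j + 1) + a (j + 2) + b (j + 1)" for j
    unfolding neighbours_GP[OF n(2)] a_def b_def
    using rim_indices_distinct[OF n(3,4), of j] by (subst card4) auto
  moreover have "card (insert (Inner ((j + k) mod n)) (neighbours (GP n k) (Inner ((j + k) mod n))) \<inter> S)
      = b j + b (j + k) + b (j + 2 * k) + a (j + k)" for j
    unfolding neighbours_GP[OF n(2)] a_def b_def
    using rim_indices_distinct[OF assms(3,4), of j] by (subst card4) auto
  ultimately show ?thesis
    unfolding perfect_code_def ball_vertices_GP_shift[OF n(1,2)] by simp
qed


section \<open>The code equations for step three\<close>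

text \<open>The condition on \<open>a\<close> alone, from the inner equation with \<open>b\<close> eliminated.\<close>

lemma outer_window_sum:
  fixes a b :: "nat \<Rightarrow> nat"
  assumes outer: "\<And>j. a j + a (j + 1) + a (j + 2) + b (j + 1) = 1"
    and inner: "\<And>j. b j + b (j + 3) + b (j + 6) + a (j + 3) = 1"
  shows "a j + a (j + 1) + a (j + 2) + a (j + 3) + a (j + 5) + a (j + 6) + a (j + 7) + a (j + 8) = 2"
  using outer[of j] outer[of "j + 3"] outer[of "j + 6"] inner[of "j + 1"]
  by (simp add: numeral_eq_Suc)

text \<open>
  Ones at distance \<open>3\<close> are excluded by the windows around \<open>i + 1\<close> and \<open>i - 1\<close>, where
  \<open>i = m + 5\<close> is the index of the given one; the shift keeps the index \<open>i - 5\<close> at the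
  left end of the second window natural.
\<close>

lemma outer_ones_period_four:
  fixes a :: "nat \<Rightarrow> nat"
  assumes sparse: "\<And>j. a j + a (j + 1) + a (j + 2) \<le> 1"
    and window: "\<And>j. a j + a (j + 1) + a (j + 2) + a (j + 3) +
                      a (j + 5) + a (j + 6) + a (j + 7) + a (j + 8) = 2"
    and one: "a (m + 5) = 1"
  shows "a (m + 9) = 1"
proof -
  note around_i = window[of "m + 1"] sparse[of "m + 1"] sparse[of "m + 3"] sparse[of "m + 4"]
    sparse[of "m + 5"] sparse[of "m + 7"]
  have next_one: "a (m + 8) + a (m + 9) = 1" and previous_one: "a (m + 1) + a (m + 2) = 1"
    using around_i one by (simp_all add: numeral_eq_Suc)
  have "a (m + 8) = 0"
  proof (rule ccontr)
    assume "a (m + 8) \<noteq> 0"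
    hence "a (m + 8) = 1" using next_one by simp
    moreover from this have "a (m + 2) = 0"
      using window[of "m + 2"] one by (simp add: numeral_eq_Suc)
    ultimately show False
      using window[of m] previous_one one by simp
  qed
  thus ?thesis using next_one by simp
qed

text \<open>
  Along the period \<open>n\<close> and along steps of \<open>4\<close> a one moves to a one; unless \<open>4\<close> divides \<open>n\<close>,
  this produces two ones at distance \<open>1\<close> or \<open>2\<close>.
\<close>

lemma four_dvd_period:
  fixes a b :: "nat \<Rightarrow> nat"
  assumes outer: "\<And>j. a j + a (j + 1) + a (j + 2) + b (j + 1) = 1"
    and inner: "\<And>j. b j + b (j + 3) + b (j + 6) + a (j + 3) = 1"
    and periodic: "\<And>j. a (j + n) = a j"
  shows "4 dvd n"
proof -
  have sparse: "a j + a (j + 1) + a (j + 2) \<le> 1" for j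
    using outer[of j] by simp
  note window = outer_window_sum[of a b, OF outer inner]
  have step: "a (i + 4) = 1" if "a i = 1" "i \<ge> 5" for i
    using outer_ones_period_four[OF sparse window, of "i - 5"] that by (simp add: add.commute)
  have steps: "a (i + 4 * q) = 1" if "a i = 1" "i \<ge> 5" for i q
  proof (induction q)
    case (Suc q)
    from step[OF this] that show ?case by (simp add: ac_simps)
  qed (use that in simp)
  obtain i where i: "i \<ge> 5" "a i = 1"
  proof -
    have "\<exists>i\<in>{5,6,7,8,10,11,12,13}. a i \<noteq> 0"
      using window[of 5] by (auto intro: ccontr)
    then obtain i where "i \<in> {5,6,7,8,10,11,12,13}" "a i \<noteq> 0" by blast
    hence "i \<ge> 5" "a i \<noteq> 0" by auto
    moreover from this have "a i = 1" using sparse[of i] by simp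
    ultimately show ?thesis using that by blast
  qed
  define c where "c = i + 4 * (n div 4)"
  have run: "a c = 1" "a (c + 4) = 1"
    using steps[OF i(2,1), of "n div 4"] steps[OF i(2,1), of "n div 4 + 1"]
    by (simp_all add: c_def ac_simps)
  have "i + n = c + n mod 4" by (simp add: c_def)
  hence shifted: "a (c + n mod 4) = 1" using periodic[of i] i by simp
  have neq: "a (c + 1) \<noteq> 1" "a (c + 2) \<noteq> 1" "a (c + 3) \<noteq> 1"
    using run sparse[of c] sparse[of "c + 2"] by (simp_all add: numeral_eq_Suc)
  have "n mod 4 = 0 \<or> n mod 4 = 1 \<or> n mod 4 = 2 \<or> n mod 4 = 3" by linarith
  hence "n mod 4 = 0"
    using shifted neq by (elim disjE) simp_all
  thus ?thesis by auto
qed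

lemma perfect_code_GP_3:
  assumes "4 dvd n" "n \<ge> 7"
  shows "perfect_code (GP n 3) ({Outer i |i. i < n \<and> i mod 4 = 0} \<union> {Inner i |i. i < n \<and> i mod 4 = 2})"
    (is "perfect_code _ ?S")
proof -
  have n: "1 \<le> (3::nat)" "2 * 3 < n" using assms by auto
  have mem: "Outer (j mod n) \<in> ?S \<longleftrightarrow> j mod 4 = 0" "Inner (j mod n) \<in> ?S \<longleftrightarrow> j mod 4 = 2" for j
    using assms by (auto simp: mod_mod_cancel)
  have "?S \<subseteq> vertices (GP n 3)" by (auto simp: vertices_GP)
  moreover have
    "of_bool (j mod 4 = 0) + of_bool ((j + 1) mod 4 = 0) + of_bool ((j + 2) mod 4 = 0)
       + of_bool ((j + 1) mod 4 = 2) = (1::nat)"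
    "of_bool (j mod 4 = 2) + of_bool ((j + 3) mod 4 = 2) + of_bool ((j + 2 * 3) mod 4 = 2)
       + of_bool ((j + 3) mod 4 = 0) = (1::nat)" for j :: nat
    unfolding of_bool_def by presburger+
  ultimately show ?thesis
    unfolding perfect_code_GP_iff[OF n] mem by blast
qed

theorem theorem3p4:
  fixes n :: nat
  assumes "n \<ge> 7"
  shows "(4 dvd n \<longrightarrow> (\<exists>T. perfect_coloring (GP n 3) 2 A4 T)) \<and>
         (\<not> 4 dvd n \<longrightarrow> \<not> (\<exists>T. perfect_coloring (GP n 3) 2 A4 T))"
proof -
  have n: "1 \<le> (3::nat)" "2 * 3 < n" using assms by auto
  have "vertices (GP n 3) \<noteq> {}" using assms by (auto simp: vertices_GP)
  note code = ex_perfect_coloring_A4_iff[OF cubic_GP[OF n] this]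
  have "4 dvd n" if "perfect_code (GP n 3) S" for S
  proof (rule four_dvd_period)
    let ?a = "\<lambda>i. of_bool (Outer (i mod n) \<in> S) :: nat"
    let ?b = "\<lambda>i. of_bool (Inner (i mod n) \<in> S) :: nat"
    show "?a j + ?a (j + 1) + ?a (j + 2) + ?b (j + 1) = 1"
      "?b j + ?b (j + 3) + ?b (j + 6) + ?a (j + 3) = 1" for j
      using that unfolding perfect_code_GP_iff[OF n] by simp_all
    show "?a (j + n) = ?a j" for j by simp
  qed
  thus ?thesis unfolding code using perfect_code_GP_3 assms by blast
qed

end
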